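(* Assume that $(X,d)$ is a metric space and that $\delta$ is an asymmetric metric on $X$ satisfying (bL) and (ic). Then the map $$\tilde\iota_{\mathrm{Bnd}}:X\longrightarrow C_{\mathrm{Bnd}}(X)/\mathbb R,\qquad p\longmapsto \delta_p+\mathbb R,\qquad \text{where }\delta_p=\delta(p,-),$$ is a topological embedding.
   Context: An asymmetric metric on $X$ is a map $\delta:X\times X\to\mathbb R$ with $\delta(u,v)\ge0$, $\delta(u,v)=0$ iff $u=v$, and $\delta(u,w)\le\delta(u,v)+\delta(v,w)$ for all $u,v,w\in X$ (no symmetry required). (bL): there are real constants $\alpha,\beta>0$ such that $d(p,q)\le\alpha\,\delta(p,q)$ and $\delta(p,q)\le\beta\,d(p,q)$ for all $p,q\in X$. (ic): for all $p,q\in X$ and $s\in[0,\delta(p,q)]$ there is $z\in X$ with $\delta(p,q)=\delta(p,z)+\delta(z,q)$ and $\delta(p,z)=s$. $C_{\mathrm{Bnd}}(X)$ is the real vector space of continuous real functions on $X$ that are bounded on all $d$-bounded sets, with the topology of uniform convergence on bounded sets; $\mathbb R\subseteq C_{\mathrm{Bnd}}(X)$ is the subspace of constant functions, and $C_{\mathrm{Bnd}}(X)/\mathbb R$ has the quotient topology. The topology on $X$ is the one given by $d$. *)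

theory Defs
  imports "HOL-Analysis.Analysis"
begin

section \<open>Asymmetric metrics\<close>

definition asymmetric_metric :: "'a set \<Rightarrow> ('a \<Rightarrow> 'a \<Rightarrow> real) \<Rightarrow> bool" where
  "asymmetric_metric X \<delta> \<longleftrightarrow>
     (\<forall>u\<in>X. \<forall>v\<in>X. 0 \<le> \<delta> u v) \<and>
     (\<forall>u\<in>X. \<forall>v\<in>X. \<delta> u v = 0 \<longleftrightarrow> u = v) \<and>
     (\<forall>u\<in>X. \<forall>v\<in>X. \<forall>w\<in>X. \<delta> u w \<le> \<delta> u v + \<delta> v w)"

definition cond_bL :: "'a set \<Rightarrow> ('a \<Rightarrow> 'a \<Rightarrow> real) \<Rightarrow> ('a \<Rightarrow> 'a \<Rightarrow> real) \<Rightarrow> bool" where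
  "cond_bL X d \<delta> \<longleftrightarrow>
     (\<exists>\<alpha>>0. \<exists>\<beta>>0. \<forall>p\<in>X. \<forall>q\<in>X. d p q \<le> \<alpha> * \<delta> p q \<and> \<delta> p q \<le> \<beta> * d p q)"

definition cond_ic :: "'a set \<Rightarrow> ('a \<Rightarrow> 'a \<Rightarrow> real) \<Rightarrow> bool" where
  "cond_ic X \<delta> \<longleftrightarrow>
     (\<forall>p\<in>X. \<forall>q\<in>X. \<forall>s\<in>{0..\<delta> p q}. \<exists>z\<in>X. \<delta> p q = \<delta> p z + \<delta> z q \<and> \<delta> p z = s)"

section \<open>Quotient topologies\<close>

definition quotient_topology :: "'a topology \<Rightarrow> ('a \<Rightarrow> 'b) \<Rightarrow> 'b topology" where
  "quotient_topology T q =
     topology (\<lambda>V. V \<subseteq> q ` topspace T \<and> openin T {x \<in> topspace T. q x \<in> V})"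

lemma openin_quotient_topology:
  "openin (quotient_topology T q) V \<longleftrightarrow>
     V \<subseteq> q ` topspace T \<and> openin T {x \<in> topspace T. q x \<in> V}"
proof -
  have "istopology (\<lambda>V. V \<subseteq> q ` topspace T \<and> openin T {x \<in> topspace T. q x \<in> V})"
    unfolding istopology_def
  proof (intro conjI allI impI)
    fix S U
    assume "S \<subseteq> q ` topspace T \<and> openin T {x \<in> topspace T. q x \<in> S}"
      and "U \<subseteq> q ` topspace T \<and> openin T {x \<in> topspace T. q x \<in> U}"
    moreover have "{x \<in> topspace T. q x \<in> S \<inter> U} =
        {x \<in> topspace T. q x \<in> S} \<inter> {x \<in> topspace T. q x \<in> U}" by auto
    ultimately show "S \<inter> U \<subseteq> q ` topspace T" "openin T {x \<in> topspace T. q x \<in> S \<inter> U}"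
      by auto
  next
    fix K
    assume *: "\<forall>S\<in>K. S \<subseteq> q ` topspace T \<and> openin T {x \<in> topspace T. q x \<in> S}"
    then show "\<Union> K \<subseteq> q ` topspace T" by blast
    have "{x \<in> topspace T. q x \<in> \<Union> K} = (\<Union>S\<in>K. {x \<in> topspace T. q x \<in> S})" by auto
    with * show "openin T {x \<in> topspace T. q x \<in> \<Union> K}" by auto
  qed
  then show ?thesis by (simp add: quotient_topology_def)
qed

lemma topspace_quotient_topology [simp]:
  "topspace (quotient_topology T q) = q ` topspace T"
proof
  show "topspace (quotient_topology T q) \<subseteq> q ` topspace T"
    by (meson openin_quotient_topology openin_topspace)
  have "{x \<in> topspace T. q x \<in> q ` topspace T} = topspace T" by auto
  then have "openin (quotient_topology T q) (q ` topspace T)"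
    by (simp add: openin_quotient_topology)
  then show "q ` topspace T \<subseteq> topspace (quotient_topology T q)"
    by (rule openin_subset)
qed

lemma quotient_map_quotient_topology: "quotient_map T (quotient_topology T q) q"
  by (simp add: quotient_map_def openin_quotient_topology)

section \<open>Continuous functions that are bounded on bounded sets\<close>

text \<open>Real functions on the carrier \<open>M\<close> are represented by the extensional ones, so that
  equality of representatives is equality on \<open>M\<close>.\<close>

context Metric_space
begin

definition CBnd :: "('a \<Rightarrow> real) set" where
  "CBnd = {f \<in> extensional M. continuous_map mtopology euclideanreal f \<and>
             (\<forall>B. mbounded B \<longrightarrow> bounded (f ` B))}"

text \<open>The sets \<open>{g \<in> CBnd. \<forall>x\<in>B. \<bar>g x - f x\<bar> < e}\<close> with \<open>B\<close> bounded and \<open>e > 0\<close> form a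
  neighbourhood base at \<open>f\<close>.\<close>

definition CBnd_topology :: "('a \<Rightarrow> real) topology" where
  "CBnd_topology = topology (\<lambda>U. U \<subseteq> CBnd \<and>
     (\<forall>f\<in>U. \<exists>B e. mbounded B \<and> e > 0 \<and> {g \<in> CBnd. \<forall>x\<in>B. \<bar>g x - f x\<bar> < e} \<subseteq> U))"

definition const_funs :: "('a \<Rightarrow> real) set" where
  "const_funs = {\<lambda>x\<in>M. c | c. True}"

definition const_coset :: "('a \<Rightarrow> real) \<Rightarrow> ('a \<Rightarrow> real) set" where
  "const_coset f = {\<lambda>x\<in>M. f x + k x | k. k \<in> const_funs}"

definition CBnd_mod_const_topology :: "('a \<Rightarrow> real) set topology" where
  "CBnd_mod_const_topology = quotient_topology CBnd_topology const_coset"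

lemma openin_CBnd_topology:
  "openin CBnd_topology U \<longleftrightarrow> U \<subseteq> CBnd \<and>
     (\<forall>f\<in>U. \<exists>B e. mbounded B \<and> e > 0 \<and> {g \<in> CBnd. \<forall>x\<in>B. \<bar>g x - f x\<bar> < e} \<subseteq> U)"
proof -
  define N where "N f B e = {g \<in> CBnd. \<forall>x\<in>B. \<bar>g x - f x\<bar> < e}" for f B and e :: real
  define P where "P U \<longleftrightarrow> U \<subseteq> CBnd \<and> (\<forall>f\<in>U. \<exists>B e. mbounded B \<and> e > 0 \<and> N f B e \<subseteq> U)" for U
  have "istopology P"
    unfolding istopology_def
  proof (intro conjI allI impI)
    fix S T assume S: "P S" and T: "P T"
    have "\<exists>B e. mbounded B \<and> e > 0 \<and> N f B e \<subseteq> S \<inter> T" if f: "f \<in> S \<inter> T" for f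
    proof -
      obtain B e where 1: "mbounded B" "e > 0" "N f B e \<subseteq> S"
        using S f unfolding P_def by blast
      obtain C r where 2: "mbounded C" "r > 0" "N f C r \<subseteq> T"
        using T f unfolding P_def by blast
      have "N f (B \<union> C) (min e r) \<subseteq> N f B e \<inter> N f C r"
        by (auto simp: N_def)
      with 1 2 show ?thesis
        by (intro exI[of _ "B \<union> C"] exI[of _ "min e r"]) (auto simp: mbounded_Un)
    qed
    with S T show "P (S \<inter> T)" unfolding P_def by blast
  next
    fix K assume K: "\<forall>S\<in>K. P S"
    show "P (\<Union> K)"
      unfolding P_def
    proof (intro conjI ballI)
      show "\<Union> K \<subseteq> CBnd" using K by (auto simp: P_def)
      fix f assume "f \<in> \<Union> K"
      then obtain S where S: "S \<in> K" "f \<in> S" by blast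
      then obtain B e where "mbounded B" "e > 0" "N f B e \<subseteq> S"
        using K unfolding P_def by blast
      with S show "\<exists>B e. mbounded B \<and> e > 0 \<and> N f B e \<subseteq> \<Union> K" by blast
    qed
  qed
  then have "openin (topology P) U \<longleftrightarrow> P U" by simp
  then show ?thesis unfolding CBnd_topology_def P_def N_def .
qed

lemma topspace_CBnd_topology [simp]: "topspace CBnd_topology = CBnd"
proof
  show "topspace CBnd_topology \<subseteq> CBnd"
    using openin_CBnd_topology openin_topspace by blast
  have "\<exists>B e::real. mbounded B \<and> e > 0 \<and> {g \<in> CBnd. \<forall>x\<in>B. \<bar>g x - f x\<bar> < e} \<subseteq> CBnd" for f
    by (intro exI[of _ "{}"] exI[of _ 1]) auto
  then have "openin CBnd_topology CBnd" by (simp add: openin_CBnd_topology)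
  then show "CBnd \<subseteq> topspace CBnd_topology" by (rule openin_subset)
qed

lemma limitin_CBnd_topology:
  "limitin CBnd_topology f l F \<longleftrightarrow>
     l \<in> CBnd \<and> (\<forall>\<^sub>F i in F. f i \<in> CBnd) \<and> (\<forall>B. mbounded B \<longrightarrow> uniform_limit B f l F)"
proof (intro iffI conjI allI impI)
  assume L: "limitin CBnd_topology f l F"
  then show l: "l \<in> CBnd" using limitin_topspace by fastforce
  have "openin CBnd_topology CBnd" by (metis openin_topspace topspace_CBnd_topology)
  with L l show "\<forall>\<^sub>F i in F. f i \<in> CBnd" by (auto simp: limitin_def)
  fix B assume B: "mbounded B"
  show "uniform_limit B f l F"
    unfolding uniform_limit_iff
  proof (intro allI impI)
    fix e :: real assume e: "e > 0"
    define U where "U = {g \<in> CBnd. \<exists>r<e. \<forall>x\<in>B. \<bar>g x - l x\<bar> \<le> r}"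
    have "\<exists>C s. mbounded C \<and> s > 0 \<and> {h \<in> CBnd. \<forall>x\<in>C. \<bar>h x - g x\<bar> < s} \<subseteq> U" if g: "g \<in> U" for g
    proof -
      obtain r where r: "r < e" "\<forall>x\<in>B. \<bar>g x - l x\<bar> \<le> r" using g by (auto simp: U_def)
      have "h \<in> U" if h: "h \<in> CBnd" "\<forall>x\<in>B. \<bar>h x - g x\<bar> < (e - r) / 2" for h
      proof -
        have "\<forall>x\<in>B. \<bar>h x - l x\<bar> \<le> (e + r) / 2" 
        proof
          fix x assume x: "x \<in> B"
          have "\<bar>h x - g x\<bar> < e / 2 - r / 2" "\<bar>g x - l x\<bar> \<le> r"
            using h(2) r(2) x by (auto simp: diff_divide_distrib)
          then have "\<bar>h x - l x\<bar> \<le> e / 2 + r / 2" by linarith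
          then show "\<bar>h x - l x\<bar> \<le> (e + r) / 2" by (simp add: add_divide_distrib)
        qed
        moreover have "(e + r) / 2 < e" using r by simp
        ultimately show ?thesis using h(1) unfolding U_def by blast
      qed
      then show ?thesis using B r(1)
        by (intro exI[of _ B] exI[of _ "(e - r) / 2"]) auto
    qed
    then have "openin CBnd_topology U" by (auto simp: openin_CBnd_topology U_def)
    moreover have "l \<in> U" using l e by (auto simp: U_def intro: exI[of _ 0])
    ultimately have "\<forall>\<^sub>F i in F. f i \<in> U" using L by (auto simp: limitin_def)
    then show "\<forall>\<^sub>F i in F. \<forall>x\<in>B. dist (f i x) (l x) < e"
      by (rule eventually_mono) (force simp: U_def dist_real_def)
  qed
next
  assume R: "l \<in> CBnd \<and> (\<forall>\<^sub>F i in F. f i \<in> CBnd) \<and> (\<forall>B. mbounded B \<longrightarrow> uniform_limit B f l F)"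
  show "limitin CBnd_topology f l F"
    unfolding limitin_def
  proof (intro conjI allI impI)
    show "l \<in> topspace CBnd_topology" using R by simp
    fix U assume U: "openin CBnd_topology U \<and> l \<in> U"
    then obtain B e where B: "mbounded B" "e > 0"
      "{g \<in> CBnd. \<forall>x\<in>B. \<bar>g x - l x\<bar> < e} \<subseteq> U"
      using openin_CBnd_topology by meson
    have "\<forall>\<^sub>F i in F. \<forall>x\<in>B. dist (f i x) (l x) < e"
      using R B by (auto simp: uniform_limit_iff)
    with R have "\<forall>\<^sub>F i in F. f i \<in> CBnd \<and> (\<forall>x\<in>B. dist (f i x) (l x) < e)"
      by (auto intro: eventually_conj)
    then show "\<forall>\<^sub>F i in F. f i \<in> U"
      by (rule eventually_mono) (use B in \<open>auto simp: dist_real_def\<close>)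
  qed
qed

end

end

theory Submission
  imports Defs
begin

text \<open>
  The functions \<open>\<delta>\<^sub>p\<close> depend on \<open>p\<close> in a uniformly Lipschitz way, which gives continuity.
  For the inverse, fix \<open>p\<close> and \<open>s > 0\<close>. If \<open>\<delta>(q,p) \<ge> s\<close>, then (ic) provides a point \<open>z\<close> with
  \<open>\<delta>(q,p) = \<delta>(q,z) + \<delta>(z,p)\<close> and \<open>\<delta>(z,p) = s\<close>; it lies in a fixed ball around \<open>p\<close>, however
  far away \<open>q\<close> is, and the function \<open>\<delta>\<^sub>q - \<delta>\<^sub>p\<close> drops by \<open>s + \<delta>(p,z) \<ge> s\<close> from \<open>p\<close> to \<open>z\<close>.
  Hence if the variation of \<open>\<delta>\<^sub>q - \<delta>\<^sub>p\<close> on that ball, which is insensitive to additive constants,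
  stays below \<open>s\<close>, then \<open>\<delta>(q,p) < s\<close>.
\<close>

section \<open>A neighbourhood criterion for topological embeddings\<close>

lemma embedding_map_if_nhds:
  assumes cont: "continuous_map T Y f" and inj: "inj_on f (topspace T)"
    and nhd: "\<And>U p. openin T U \<Longrightarrow> p \<in> U \<Longrightarrow>
      \<exists>W. openin Y W \<and> f p \<in> W \<and> {q \<in> topspace T. f q \<in> W} \<subseteq> U"
  shows "embedding_map T Y f"
  unfolding embedding_map_def
proof (rule bijective_open_imp_homeomorphic_map)
  let ?S = "subtopology Y (f ` topspace T)"
  show "continuous_map T ?S f"
    using cont by (simp add: continuous_map_in_subtopology)
  show "f ` topspace T = topspace ?S"
    using continuous_map_image_subset_topspace[OF cont] by auto
  show "open_map T ?S f"
    unfolding open_map_def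
  proof (intro allI impI)
    fix U assume U: "openin T U"
    let ?W = "\<Union>{W. openin Y W \<and> {q \<in> topspace T. f q \<in> W} \<subseteq> U}"
    have "f ` U = ?W \<inter> f ` topspace T"
      using nhd[OF U] openin_subset[OF U] by fast
    moreover have "openin Y ?W" by auto
    ultimately show "openin ?S (f ` U)"
      unfolding openin_subtopology by blast
  qed
qed (rule inj)

section \<open>Cosets of constants and open sets in the quotient\<close>

context Metric_space
begin

text \<open>Extensionality makes adding the zero constant return \<open>f\<close> itself, so
  \<open>f\<close> lies in its own coset and hence in that of \<open>g\<close>.\<close>

lemma const_coset_eqD:
  assumes "const_coset f = const_coset g" and "f \<in> extensional M"
  obtains c where "\<And>x. x \<in> M \<Longrightarrow> f x = g x + c"
proof -
  have "(\<lambda>x\<in>M. 0) \<in> const_funs" by (auto simp: const_funs_def)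
  moreover have "f = (\<lambda>x\<in>M. f x + (\<lambda>x\<in>M. 0) x)"
    using assms(2) by (auto simp: extensional_def)
  ultimately have "f \<in> const_coset f" unfolding const_coset_def by blast
  then have "f \<in> const_coset g" using assms(1) by simp
  then obtain c where "f = (\<lambda>x\<in>M. g x + (\<lambda>x\<in>M. c) x)"
    by (auto simp: const_coset_def const_funs_def)
  then have "f x = g x + c" if "x \<in> M" for x using that by simp
  then show ?thesis by (rule that)
qed

text \<open>The bound \<open>r < s\<close> makes the set open: a pointwise strict inequality would not be stable
  under uniform approximation.\<close>

definition osc_nhd :: "('a \<Rightarrow> real) \<Rightarrow> 'a \<Rightarrow> 'a set \<Rightarrow> real \<Rightarrow> ('a \<Rightarrow> real) set" where
  "osc_nhd f p B s = {g \<in> CBnd. \<exists>r<s. \<forall>x\<in>B. \<bar>(g x - f x) - (g p - f p)\<bar> \<le> r}"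

text \<open>Moving \<open>g\<close> by less than \<open>e\<close> on \<open>B\<close> changes the
  difference between the values at \<open>x\<close> and \<open>p\<close> by less than
  \<open>2 * e\<close>, since \<open>p\<close> also lies in \<open>B\<close>; the gap between
  \<open>r\<close> and \<open>s\<close> absorbs this.\<close>

lemma openin_osc_nhd:
  assumes B: "mbounded B" and p: "p \<in> B"
  shows "openin CBnd_topology (osc_nhd f p B s)"
  unfolding openin_CBnd_topology
proof (intro conjI ballI)
  show "osc_nhd f p B s \<subseteq> CBnd" by (auto simp: osc_nhd_def)
  fix g assume "g \<in> osc_nhd f p B s"
  then obtain r where r: "r < s" "\<And>x. x \<in> B \<Longrightarrow> \<bar>(g x - f x) - (g p - f p)\<bar> \<le> r"
    by (auto simp: osc_nhd_def)
  \<comment> \<open>With this choice \<open>r + 2 * e\<close> is the midpoint of \<open>r\<close>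
    and \<open>s\<close>.\<close>
  define e where "e = (s - r) / 4"
  have e: "e > 0" "r + 2 * e < s" using r(1) by (auto simp: e_def field_simps)
  have "h \<in> osc_nhd f p B s" if h: "h \<in> CBnd" "\<forall>x\<in>B. \<bar>h x - g x\<bar> < e" for h
  proof -
    have "\<bar>(h x - f x) - (h p - f p)\<bar> \<le> r + 2 * e" if x: "x \<in> B" for x
      using bspec[OF h(2) x] bspec[OF h(2) p] r(2)[OF x] by linarith
    then show ?thesis using h(1) e(2) unfolding osc_nhd_def by blast
  qed
  then show "\<exists>C e. mbounded C \<and> e > 0 \<and> {h \<in> CBnd. \<forall>x\<in>C. \<bar>h x - g x\<bar> < e} \<subseteq> osc_nhd f p B s"
    using B e(1) by blast
qed

text \<open>An additive constant cancels between the values at \<open>x\<close> and at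
  \<open>p\<close>, so membership depends only on the coset.\<close>

lemma osc_nhd_saturated:
  assumes B: "B \<subseteq> M" "p \<in> B" and g: "g \<in> CBnd" "const_coset g \<in> const_coset ` osc_nhd f p B s"
  shows "g \<in> osc_nhd f p B s"
proof -
  obtain h where h: "h \<in> osc_nhd f p B s" "const_coset g = const_coset h" using g by blast
  have "g \<in> extensional M" using g(1) by (simp add: CBnd_def)
  with h(2) obtain c where c: "\<And>x. x \<in> M \<Longrightarrow> g x = h x + c"
    by (rule const_coset_eqD) blast
  have "(g x - f x) - (g p - f p) = (h x - f x) - (h p - f p)" if "x \<in> B" for x
    using c[of x] c[of p] subsetD[OF B(1)] B(2) that by simp
  then have "(\<forall>x\<in>B. \<bar>(g x - f x) - (g p - f p)\<bar> \<le> r) \<longleftrightarrow>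
      (\<forall>x\<in>B. \<bar>(h x - f x) - (h p - f p)\<bar> \<le> r)" for r
    by (metis (mono_tags, lifting))
  with h(1) g(1) show ?thesis unfolding osc_nhd_def by blast
qed

text \<open>A saturated open set has open image under a quotient map.\<close>

lemma openin_const_coset_osc_nhd:
  assumes B: "mbounded B" and p: "p \<in> B"
  shows "openin CBnd_mod_const_topology (const_coset ` osc_nhd f p B s)"
proof -
  have "B \<subseteq> M" using B by (rule mbounded_subset_mspace)
  moreover have "osc_nhd f p B s \<subseteq> CBnd" by (auto simp: osc_nhd_def)
  ultimately have "{g \<in> CBnd. const_coset g \<in> const_coset ` osc_nhd f p B s} = osc_nhd f p B s"
    using osc_nhd_saturated[OF _ p] by blast
  then show ?thesis
    using openin_osc_nhd[OF B p] \<open>osc_nhd f p B s \<subseteq> CBnd\<close>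
    unfolding CBnd_mod_const_topology_def openin_quotient_topology by auto
qed

section \<open>Lipschitz estimates and continuity of the map into the quotient\<close>

context
  fixes \<delta> :: "'a \<Rightarrow> 'a \<Rightarrow> real" and \<beta> :: real
  assumes asym: "asymmetric_metric M \<delta>"
    and \<beta>: "\<beta> > 0" "\<And>p q. p \<in> M \<Longrightarrow> q \<in> M \<Longrightarrow> \<delta> p q \<le> \<beta> * d p q"
begin

lemma asym_nonneg: "p \<in> M \<Longrightarrow> q \<in> M \<Longrightarrow> 0 \<le> \<delta> p q"
  and asym_eq_0: "p \<in> M \<Longrightarrow> \<delta> p p = 0"
  and asym_triangle: "p \<in> M \<Longrightarrow> q \<in> M \<Longrightarrow> r \<in> M \<Longrightarrow> \<delta> p r \<le> \<delta> p q + \<delta> q r"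
  using asym by (auto simp: asymmetric_metric_def)

text \<open>The triangle inequality bounds the two signs by \<open>\<delta> p q\<close> and
  \<open>\<delta> q p\<close>; the symmetry of \<open>d\<close> gives both the same bound.\<close>

lemma asym_Lipschitz_left:
  assumes "p \<in> M" "q \<in> M" "x \<in> M"
  shows "\<bar>\<delta> p x - \<delta> q x\<bar> \<le> \<beta> * d p q"
  using asym_triangle[of p q x] asym_triangle[of q p x] \<beta>(2)[of p q] \<beta>(2)[of q p] assms
  by (simp add: commute)

lemma asym_Lipschitz_right:
  assumes "p \<in> M" "x \<in> M" "y \<in> M"
  shows "\<bar>\<delta> p x - \<delta> p y\<bar> \<le> \<beta> * d x y"
  using asym_triangle[of p x y] asym_triangle[of p y x] \<beta>(2)[of x y] \<beta>(2)[of y x] assms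
  by (simp add: commute)

lemma asym_in_CBnd:
  assumes p: "p \<in> M"
  shows "(\<lambda>x\<in>M. \<delta> p x) \<in> CBnd"
  unfolding CBnd_def
proof (intro CollectI conjI allI impI)
  show "continuous_map mtopology euclideanreal (\<lambda>x\<in>M. \<delta> p x)"
    \<comment> \<open>Viewing the reals as a metric topology makes the epsilon-delta criterion
      applicable.\<close>
    unfolding mtopology_is_euclidean[symmetric]
    unfolding metric_continuous_map[OF Met_TC.Metric_space_axioms]
  proof (intro conjI ballI allI impI)
    fix x and e :: real assume x: "x \<in> M" and e: "e > 0"
    show "\<exists>r>0. \<forall>y. y \<in> M \<and> d x y < r \<longrightarrow> dist ((\<lambda>x\<in>M. \<delta> p x) x) ((\<lambda>x\<in>M. \<delta> p x) y) < e"
    proof (intro exI[of _ "e / \<beta>"] conjI allI impI)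
      fix y assume y: "y \<in> M \<and> d x y < e / \<beta>"
      then have "\<beta> * d x y < e" using \<beta>(1) by (simp add: field_simps)
      then show "dist ((\<lambda>x\<in>M. \<delta> p x) x) ((\<lambda>x\<in>M. \<delta> p x) y) < e"
        using asym_Lipschitz_right[OF p x] x y by (force simp: dist_real_def)
    qed (use e \<beta> in simp)
  qed auto
  fix B assume B: "mbounded B"
  \<comment> \<open>Adding \<open>p\<close> to \<open>B\<close> keeps it bounded, so distances
    measured from \<open>p\<close> have a common bound.\<close>
  then obtain b where b: "\<And>x. x \<in> B \<Longrightarrow> d p x \<le> b"
    using p mbounded_insert[of p B] mbounded_alt[of "insert p B"] by auto
  show "bounded ((\<lambda>x\<in>M. \<delta> p x) ` B)"
    unfolding bounded_iff
  proof (intro exI[of _ "\<beta> * b"] ballI)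
    fix y assume "y \<in> (\<lambda>x\<in>M. \<delta> p x) ` B"
    then obtain x where x: "x \<in> B" "x \<in> M" "y = \<delta> p x"
      using mbounded_subset_mspace[OF B] by auto
    have "\<delta> p x \<le> \<beta> * b"
      using \<beta>(2)[OF p x(2)] mult_left_mono[OF b[OF x(1)], of \<beta>] \<beta>(1) by linarith
    then show "norm y \<le> \<beta> * b"
      using asym_nonneg[OF p x(2)] x(3) by simp
  qed
qed auto

text \<open>The Lipschitz bound in the first argument is uniform in \<open>x\<close>, so the radius
  \<open>e / \<beta>\<close> serves for every bounded set \<open>B\<close>.\<close>

lemma continuous_map_asym:
  "continuous_map mtopology CBnd_topology (\<lambda>p. \<lambda>x\<in>M. \<delta> p x)"
  unfolding continuous_map_def
proof (intro conjI allI impI)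
  show "(\<lambda>p. \<lambda>x\<in>M. \<delta> p x) \<in> topspace mtopology \<rightarrow> topspace CBnd_topology"
    using asym_in_CBnd by simp
  fix U assume U: "openin CBnd_topology U"
  show "openin mtopology {p \<in> topspace mtopology. (\<lambda>x\<in>M. \<delta> p x) \<in> U}"
    unfolding openin_mtopology
  proof (intro conjI allI impI)
    fix p assume "p \<in> {p \<in> topspace mtopology. (\<lambda>x\<in>M. \<delta> p x) \<in> U}"
    then have p: "p \<in> M" "(\<lambda>x\<in>M. \<delta> p x) \<in> U" by auto
    obtain B e where B: "mbounded B" "e > 0"
      "{g \<in> CBnd. \<forall>x\<in>B. \<bar>g x - (\<lambda>x\<in>M. \<delta> p x) x\<bar> < e} \<subseteq> U"
      using U p(2) unfolding openin_CBnd_topology by meson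
    have "(\<lambda>x\<in>M. \<delta> q x) \<in> U" if q: "q \<in> mball p (e / \<beta>)" for q
    proof -
      have q': "q \<in> M" "\<beta> * d q p < e" using q \<beta>(1) by (auto simp: field_simps commute)
      have "\<bar>(\<lambda>x\<in>M. \<delta> q x) x - (\<lambda>x\<in>M. \<delta> p x) x\<bar> < e" if "x \<in> B" for x
      proof -
        have x: "x \<in> M" using that mbounded_subset_mspace[OF B(1)] by blast
        show ?thesis using asym_Lipschitz_left[OF q'(1) p(1) x] q'(2) x by simp
      qed
      then show ?thesis using B(3) asym_in_CBnd[OF q'(1)] by blast
    qed
    then show "\<exists>r>0. mball p r \<subseteq> {p \<in> topspace mtopology. (\<lambda>x\<in>M. \<delta> p x) \<in> U}"
      using B(2) \<beta>(1) by (intro exI[of _ "e / \<beta>"]) auto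
  qed auto
qed

section \<open>Recovering the point from its coset\<close>

lemma asym_less_if_osc_nhd:
  assumes ic: "cond_ic M \<delta>"
    and \<alpha>: "\<And>p q. p \<in> M \<Longrightarrow> q \<in> M \<Longrightarrow> d p q \<le> \<alpha> * \<delta> p q"
    and p: "p \<in> M" and q: "q \<in> M" and s: "s > 0"
    and osc: "(\<lambda>x\<in>M. \<delta> q x) \<in> osc_nhd (\<lambda>x\<in>M. \<delta> p x) p (mcball p (\<alpha> * s)) s"
  shows "\<delta> q p < s"
proof (rule ccontr)
  assume "\<not> \<delta> q p < s"
  \<comment> \<open>(ic) prescribes the distance from the starting point \<open>q\<close>; the
    parameter \<open>\<delta> q p - s\<close> leaves exactly \<open>s\<close> for
    \<open>\<delta> z p\<close>.\<close>
  then have "\<delta> q p - s \<in> {0..\<delta> q p}" using s by auto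
  then obtain z where z: "z \<in> M" "\<delta> q p = \<delta> q z + \<delta> z p" "\<delta> q z = \<delta> q p - s"
    using ic p q unfolding cond_ic_def by blast
  then have "d z p \<le> \<alpha> * s" using \<alpha>[OF z(1) p] by simp
  then have "z \<in> mcball p (\<alpha> * s)" using p z(1) by (simp add: commute)
  moreover obtain r where "r < s"
    "\<forall>x\<in>mcball p (\<alpha> * s).
       \<bar>((\<lambda>x\<in>M. \<delta> q x) x - (\<lambda>x\<in>M. \<delta> p x) x) - ((\<lambda>x\<in>M. \<delta> q x) p - (\<lambda>x\<in>M. \<delta> p x) p)\<bar> \<le> r"
    using osc unfolding osc_nhd_def by blast
  ultimately have "\<bar>(\<delta> q z - \<delta> p z) - (\<delta> q p - \<delta> p p)\<bar> < s"
    using p z(1) by fastforce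
  then show False using z(3) asym_nonneg[OF p z(1)] asym_eq_0[OF p] by linarith
qed

text \<open>Common source of injectivity and of openness onto the image.\<close>

lemma asym_coset_nhd:
  assumes ic: "cond_ic M \<delta>"
    and \<alpha>: "\<alpha> > 0" "\<And>p q. p \<in> M \<Longrightarrow> q \<in> M \<Longrightarrow> d p q \<le> \<alpha> * \<delta> p q"
    and p: "p \<in> M" and e: "e > 0"
  obtains W where "openin CBnd_mod_const_topology W" "const_coset (\<lambda>x\<in>M. \<delta> p x) \<in> W"
    "\<And>q. q \<in> M \<Longrightarrow> const_coset (\<lambda>x\<in>M. \<delta> q x) \<in> W \<Longrightarrow> q \<in> mball p e"
proof -
  \<comment> \<open>Scaled so that \<open>\<delta> q p < s\<close> forces
    \<open>d q p < \<alpha> * s = e\<close>.\<close>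
  define s where "s = e / \<alpha>"
  have s: "s > 0" "\<alpha> * s = e" using e \<alpha>(1) by (auto simp: s_def)
  let ?N = "osc_nhd (\<lambda>x\<in>M. \<delta> p x) p (mcball p (\<alpha> * s)) s"
  have pB: "p \<in> mcball p (\<alpha> * s)" using p e s by simp
  show ?thesis
  proof
    show "openin CBnd_mod_const_topology (const_coset ` ?N)"
      using pB by (intro openin_const_coset_osc_nhd mbounded_mcball)
    show "const_coset (\<lambda>x\<in>M. \<delta> p x) \<in> const_coset ` ?N"
      unfolding osc_nhd_def by (intro imageI CollectI conjI exI[of _ 0] asym_in_CBnd p s(1)) auto
    fix q assume q: "q \<in> M" "const_coset (\<lambda>x\<in>M. \<delta> q x) \<in> const_coset ` ?N"
    then have "(\<lambda>x\<in>M. \<delta> q x) \<in> ?N"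
      using asym_in_CBnd pB by (intro osc_nhd_saturated) auto
    then have "\<delta> q p < s" using asym_less_if_osc_nhd ic \<alpha>(2) p q(1) s(1) by blast
    then have "d q p < e"
      using \<alpha>(2)[OF q(1) p] mult_strict_left_mono[of "\<delta> q p" s \<alpha>] \<alpha>(1) s(2) by linarith
    then show "q \<in> mball p e" using p q(1) by (simp add: commute)
  qed
qed

lemma embedding_map_asym_coset:
  assumes ic: "cond_ic M \<delta>"
    and \<alpha>: "\<alpha> > 0" "\<And>p q. p \<in> M \<Longrightarrow> q \<in> M \<Longrightarrow> d p q \<le> \<alpha> * \<delta> p q"
  shows "embedding_map mtopology CBnd_mod_const_topology (\<lambda>p. const_coset (\<lambda>x\<in>M. \<delta> p x))"
proof (rule embedding_map_if_nhds)
  have "continuous_map CBnd_topology CBnd_mod_const_topology const_coset"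
    unfolding CBnd_mod_const_topology_def
    by (rule quotient_imp_continuous_map[OF quotient_map_quotient_topology])
  from continuous_map_compose[OF continuous_map_asym this]
  show "continuous_map mtopology CBnd_mod_const_topology (\<lambda>p. const_coset (\<lambda>x\<in>M. \<delta> p x))"
    by (simp add: o_def)
  show "inj_on (\<lambda>p. const_coset (\<lambda>x\<in>M. \<delta> p x)) (topspace mtopology)"
  proof (rule inj_onI, rule ccontr)
    fix p q
    assume "p \<in> topspace mtopology" "q \<in> topspace mtopology"
      and eq: "const_coset (\<lambda>x\<in>M. \<delta> p x) = const_coset (\<lambda>x\<in>M. \<delta> q x)" and "p \<noteq> q"
    then have pq: "p \<in> M" "q \<in> M" "d p q > 0" by auto
    \<comment> \<open>Equal cosets would put \<open>q\<close> into the open ball around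
      \<open>p\<close> of radius \<open>d p q\<close>, which excludes \<open>q\<close>.\<close>
    from asym_coset_nhd[OF ic \<alpha> pq(1) pq(3)] have "q \<in> mball p (d p q)"
      using pq(2) eq by metis
    then show False by simp
  qed
  fix U p assume U: "openin mtopology U" "p \<in> U"
  then obtain e where e: "e > 0" "mball p e \<subseteq> U" and p: "p \<in> M"
    unfolding openin_mtopology by blast
  from asym_coset_nhd[OF ic \<alpha> p e(1)] obtain W
    where "openin CBnd_mod_const_topology W" "const_coset (\<lambda>x\<in>M. \<delta> p x) \<in> W"
      "\<And>q. q \<in> M \<Longrightarrow> const_coset (\<lambda>x\<in>M. \<delta> q x) \<in> W \<Longrightarrow> q \<in> mball p e" by blast
  then show "\<exists>W. openin CBnd_mod_const_topology W \<and> const_coset (\<lambda>x\<in>M. \<delta> p x) \<in> W \<and>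
      {q \<in> topspace mtopology. const_coset (\<lambda>x\<in>M. \<delta> q x) \<in> W} \<subseteq> U"
    using e(2) by (intro exI[of _ W]) auto
qed

end

end

theorem proposition4p5:
  fixes X :: "'a set" and d \<delta> :: "'a \<Rightarrow> 'a \<Rightarrow> real"
  assumes "Metric_space X d"
    and "asymmetric_metric X \<delta>"
    and "cond_bL X d \<delta>"
    and "cond_ic X \<delta>"
  shows "embedding_map (Metric_space.mtopology X d) (Metric_space.CBnd_mod_const_topology X d)
           (\<lambda>p. Metric_space.const_coset X (\<lambda>x\<in>X. \<delta> p x))"
proof -
  interpret Metric_space X d by fact
  obtain \<alpha> \<beta> where "\<alpha> > 0" "\<beta> > 0"
    "\<And>p q. p \<in> X \<Longrightarrow> q \<in> X \<Longrightarrow> d p q \<le> \<alpha> * \<delta> p q"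
    "\<And>p q. p \<in> X \<Longrightarrow> q \<in> X \<Longrightarrow> \<delta> p q \<le> \<beta> * d p q"
    using assms(3) unfolding cond_bL_def by blast
  then show ?thesis
    using embedding_map_asym_coset[of \<delta> \<beta> \<alpha>] assms(2,4) by blast
qed

end
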